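(* Let $(\Phi,\Psi,\phi,\psi)\in\mathscr{Y}\uplus\mathscr{G}$ and let $(X,\mathfrak{M},\mu)$ be a measure space endowed with a ball-basis $\mathfrak{B}$. Then the Orlicz-Morrey maximal operator $\mathcal{M}_{\mathfrak{B},\Phi,\phi}$, defined by $$\mathcal{M}_{\mathfrak{B},\Phi,\phi}f(x)=\sup_{B\in\mathfrak{B}:\,x\in B}\|f\|_{\Phi,\phi,B}\quad\text{for }x\in\bigcup_{B\in\mathfrak{B}}B,$$ and $\mathcal{M}_{\mathfrak{B},\Phi,\phi}f(x)=0$ for $x\notin\bigcup_{B\in\mathfrak{B}}B$, is a (real-valued) $\Psi$-bounded oscillation operator with respect to $\mathfrak{B}$.
   Context: **Ball-basis.** Let $(X,\mathfrak{M},\mu)$ be a measure space. A family $\mathfrak{B}\subset\mathfrak{M}$ (its members are called balls) is a ball-basis if: (B1) $0<\mu(B)<\infty$ for all $B\in\mathfrak{B}$; (B2) any two points $x,y\in X$ lie in a common $B\in\mathfrak{B}$; (B3) for every $E\in\mathfrak{M}$ and $\varepsilon>0$ there is a finite or infinite sequence $\{B_k\}\subset\mathfrak{B}$ with $\mu(E\,\Delta\,\bigcup_kB_k)<\varepsilon$; (B4) each $B\in\mathfrak{B}$ has a ball-hull $B^{\P}\in\mathfrak{B}$ containing $\bigcup\{B'\in\mathfrak{B}: B'\cap B\ne\varnothing,\ \mu(B')\le2\mu(B)\}$, such that $A\subset B\Rightarrow A^{\P}\subset B^{\P}$ and $\mu(B^{\P})\le\mathscr{C}_0\,\mu(B)$,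 where $\mathscr{C}_0\ge1$ is a fixed constant. **Function classes.** $\mathscr{Y}$: all Young functions $\Phi:[0,\infty]\to[0,\infty]$ (convex, left-continuous, $\lim_{t\to0^+}\Phi(t)=\Phi(0)=0$, $\lim_{t\to\infty}\Phi(t)=\Phi(\infty)=\infty$) with $0<\Phi(t)<\infty$ for $0<t<\infty$. $\mathscr{G}$: all $\varphi:(0,\infty)\to(0,\infty)$ for which there are $C_{dc},C_{ic}>0$ with $\varphi(r)\ge C_{dc}\varphi(s)$ and $r\varphi(r)\le C_{ic}\,s\varphi(s)$ whenever $r\le s$. $(\Phi,\Psi,\phi,\psi)\in\mathscr{Y}\uplus\mathscr{G}$ means: $\Phi,\Psi\in\mathscr{Y}$, $\phi,\psi\in\mathscr{G}$, and there are constants $C(\Phi,\Psi),C(\psi,\phi)>0$ with $\Phi(t)\le\Psi(C(\Phi,\Psi)t)$ and $\psi(t)\le C(\psi,\phi)\phi(t)$ for all $t$. **Norms and spaces.** For $B\in\mathfrak{B}$: $\|f\|_{\Phi,\phi,B}=\inf\{s>0:\frac{1}{\mu(B)\phi(\mu(B))}\int_B\Phi(|f|/s)\,d\mu\le1\}$; $\langle\|f\|\rangle_{\Phi,\phi,B}=\sup_{B'\in\mathfrak{B},\,B'\supset B}\|f\|_{\Phi,\phi,B'}$. $L^{(\Phi,\phi)}(X)$ is the set of $f\in L^1_{\rm loc}(X)$ with $\|f\|_{L^{(\Phi,\phi)}}=\sup_{B\in\mathfrak{B}}\|f\|_{\Phi,\phi,B}<\infty$. (One has $L^{(\Psi,\psi)}(X)\subset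 L^{(\Phi,\phi)}(X)$.) $\mathbb{I}_E$ is the indicator function of $E$. **Real-valued $\Psi$-BOO.** Given $(\Phi,\Psi,\phi,\psi)\in\mathscr{Y}\uplus\mathscr{G}$, a real-valued linear or sublinear operator $T$ is a $\Psi$-bounded oscillation operator ($\Psi$-BOO) with respect to $\mathfrak{B}$ if there are constants $\mathscr{C}_1(T),\mathscr{C}_2(T)\in(0,\infty)$ such that for every $f\in L^{(\Psi,\psi)}(X)$: (I) for every $B_0\in\mathfrak{B}$ with $B_0^{\P}\subsetneq X$ there is $B\in\mathfrak{B}$ with $B\supsetneq B_0$ and $\sup_{x\in B_0}|T(f\mathbb{I}_{B^{\P}})(x)-T(f\mathbb{I}_{B_0^{\P}})(x)|\le\mathscr{C}_1(T)\|f\|_{\Phi,\phi,B^{\P}}$; (II) for every $B\in\mathfrak{B}$, $\sup_{x,x'\in B}|(Tf-T(f\mathbb{I}_{B^{\P}}))(x)-(Tf-T(f\mathbb{I}_{B^{\P}}))(x')|\le\mathscr{C}_2(T)\langle\|f\|\rangle_{\Phi,\phi,B}$. *)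

theory Defs
  imports "HOL-Analysis.Analysis"
begin

text \<open>
  The underlying set of the measure space is \<open>space M\<close>. The ball-hull map and its constant are
  parameters, since the notion of bounded oscillation operator refers to the hull. In \<open>approx\<close>, a
  finite or infinite sequence of balls is given by the countable set of its members.
\<close>

locale ball_basis =
  fixes M :: "'a measure" and \<BB> :: "'a set set" and bhull :: "'a set \<Rightarrow> 'a set" and C\<^sub>0 :: real
  assumes balls_measurable: "\<BB> \<subseteq> sets M"
    and measure_pos_finite: "\<And>B. B \<in> \<BB> \<Longrightarrow> 0 < emeasure M B \<and> emeasure M B < \<infinity>"
    and common_ball: "\<And>x y. x \<in> space M \<Longrightarrow> y \<in> space M \<Longrightarrow> \<exists>B\<in>\<BB>. x \<in> B \<and> y \<in> B"
    and approx: "\<And>E \<epsilon>. E \<in> sets M \<Longrightarrow> (0::real) < \<epsilon> \<Longrightarrow>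
        \<exists>\<C>\<subseteq>\<BB>. countable \<C> \<and> emeasure M ((E - \<Union>\<C>) \<union> (\<Union>\<C> - E)) < ennreal \<epsilon>"
    and const_ge_1: "1 \<le> C\<^sub>0"
    and hull_ball: "\<And>B. B \<in> \<BB> \<Longrightarrow> bhull B \<in> \<BB>"
    and hull_contains: "\<And>B. B \<in> \<BB> \<Longrightarrow>
        \<Union>{B'\<in>\<BB>. B' \<inter> B \<noteq> {} \<and> emeasure M B' \<le> 2 * emeasure M B} \<subseteq> bhull B"
    and hull_mono: "\<And>A B. A \<in> \<BB> \<Longrightarrow> B \<in> \<BB> \<Longrightarrow> A \<subseteq> B \<Longrightarrow> bhull A \<subseteq> bhull B"
    and hull_measure: "\<And>B. B \<in> \<BB> \<Longrightarrow> emeasure M (bhull B) \<le> ennreal C\<^sub>0 * emeasure M B"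

definition young_function :: "(ennreal \<Rightarrow> ennreal) \<Rightarrow> bool" where
  "young_function \<Phi> \<longleftrightarrow>
    (\<forall>a b. \<forall>t::real. 0 \<le> t \<and> t \<le> 1 \<longrightarrow>
      \<Phi> (ennreal t * a + ennreal (1 - t) * b) \<le> ennreal t * \<Phi> a + ennreal (1 - t) * \<Phi> b) \<and>
    (\<forall>t. (\<Phi> \<longlongrightarrow> \<Phi> t) (at_left t)) \<and>
    \<Phi> 0 = 0 \<and> (\<Phi> \<longlongrightarrow> 0) (at_right 0) \<and>
    \<Phi> \<infinity> = \<infinity> \<and> (\<Phi> \<longlongrightarrow> \<infinity>) (at_left \<infinity>)"

definition young_class :: "(ennreal \<Rightarrow> ennreal) set" where
  "young_class = {\<Phi>. young_function \<Phi> \<and> (\<forall>t. 0 < t \<and> t < \<infinity> \<longrightarrow> 0 < \<Phi> t \<and> \<Phi> t < \<infinity>)}"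

text \<open>Functions on \<open>(0,\<infinity>)\<close> are total functions on the reals whose values elsewhere are irrelevant.\<close>

definition growth_class :: "(real \<Rightarrow> real) set" where
  "growth_class = {\<phi>. (\<forall>r>0. 0 < \<phi> r) \<and>
    (\<exists>C_dc>0. \<exists>C_ic>0. \<forall>r s. 0 < r \<and> r \<le> s \<longrightarrow>
      \<phi> r \<ge> C_dc * \<phi> s \<and> r * \<phi> r \<le> C_ic * (s * \<phi> s))}"

definition young_growth_quadruple ::
    "(ennreal \<Rightarrow> ennreal) \<Rightarrow> (ennreal \<Rightarrow> ennreal) \<Rightarrow> (real \<Rightarrow> real) \<Rightarrow> (real \<Rightarrow> real) \<Rightarrow> bool" where
  "young_growth_quadruple \<Phi> \<Psi> \<phi> \<psi> \<longleftrightarrow>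
    \<Phi> \<in> young_class \<and> \<Psi> \<in> young_class \<and> \<phi> \<in> growth_class \<and> \<psi> \<in> growth_class \<and>
    (\<exists>C::real. C > 0 \<and> (\<forall>t. \<Phi> t \<le> \<Psi> (ennreal C * t))) \<and>
    (\<exists>C::real. C > 0 \<and> (\<forall>t>0. \<psi> t \<le> C * \<phi> t))"

text \<open>The norms take values in \<open>[0,\<infinity>]\<close>, and the infimum of the empty set is \<open>\<infinity>\<close>.\<close>

definition orlicz_morrey_local_norm ::
    "'a measure \<Rightarrow> (ennreal \<Rightarrow> ennreal) \<Rightarrow> (real \<Rightarrow> real) \<Rightarrow> 'a set \<Rightarrow> ('a \<Rightarrow> real) \<Rightarrow> ennreal" where
  "orlicz_morrey_local_norm M \<Phi> \<phi> B f =
    Inf {ennreal s | s::real. 0 < s \<and>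
      1 / (emeasure M B * ennreal (\<phi> (measure M B))) *
        (\<integral>\<^sup>+x\<in>B. \<Phi> (ennreal (\<bar>f x\<bar> / s)) \<partial>M) \<le> 1}"

definition orlicz_morrey_sup_norm ::
    "'a measure \<Rightarrow> 'a set set \<Rightarrow> (ennreal \<Rightarrow> ennreal) \<Rightarrow> (real \<Rightarrow> real) \<Rightarrow> 'a set \<Rightarrow> ('a \<Rightarrow> real) \<Rightarrow> ennreal"
  where
  "orlicz_morrey_sup_norm M \<BB> \<Phi> \<phi> B f =
    (SUP B'\<in>{B'\<in>\<BB>. B \<subseteq> B'}. orlicz_morrey_local_norm M \<Phi> \<phi> B' f)"

definition orlicz_morrey_norm ::
    "'a measure \<Rightarrow> 'a set set \<Rightarrow> (ennreal \<Rightarrow> ennreal) \<Rightarrow> (real \<Rightarrow> real) \<Rightarrow> ('a \<Rightarrow> real) \<Rightarrow> ennreal" where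
  "orlicz_morrey_norm M \<BB> \<Phi> \<phi> f = (SUP B\<in>\<BB>. orlicz_morrey_local_norm M \<Phi> \<phi> B f)"

text \<open>Local integrability means integrability on every ball.\<close>

definition L1_loc :: "'a measure \<Rightarrow> 'a set set \<Rightarrow> ('a \<Rightarrow> real) set" where
  "L1_loc M \<BB> = {f \<in> borel_measurable M. \<forall>B\<in>\<BB>. set_integrable M B f}"

definition orlicz_morrey_space ::
    "'a measure \<Rightarrow> 'a set set \<Rightarrow> (ennreal \<Rightarrow> ennreal) \<Rightarrow> (real \<Rightarrow> real) \<Rightarrow> ('a \<Rightarrow> real) set" where
  "orlicz_morrey_space M \<BB> \<Phi> \<phi> = {f \<in> L1_loc M \<BB>. orlicz_morrey_norm M \<BB> \<Phi> \<phi> f < \<infinity>}"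

definition linear_operator_on ::
    "'a set \<Rightarrow> ('a \<Rightarrow> real) set \<Rightarrow> (('a \<Rightarrow> real) \<Rightarrow> 'a \<Rightarrow> real) \<Rightarrow> bool" where
  "linear_operator_on X V T \<longleftrightarrow>
    (\<forall>f\<in>V. \<forall>g\<in>V. \<forall>x\<in>X. T (\<lambda>y. f y + g y) x = T f x + T g x) \<and>
    (\<forall>f\<in>V. \<forall>c::real. \<forall>x\<in>X. T (\<lambda>y. c * f y) x = c * T f x)"

definition sublinear_operator_on ::
    "'a set \<Rightarrow> ('a \<Rightarrow> real) set \<Rightarrow> (('a \<Rightarrow> real) \<Rightarrow> 'a \<Rightarrow> real) \<Rightarrow> bool" where
  "sublinear_operator_on X V T \<longleftrightarrow>
    (\<forall>f\<in>V. \<forall>g\<in>V. \<forall>x\<in>X. \<bar>T (\<lambda>y. f y + g y) x\<bar> \<le> \<bar>T f x\<bar> + \<bar>T g x\<bar>) \<and>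
    (\<forall>f\<in>V. \<forall>c::real. \<forall>x\<in>X. \<bar>T (\<lambda>y. c * f y) x\<bar> = \<bar>c\<bar> * \<bar>T f x\<bar>)"

abbreviation restrict_to :: "('a \<Rightarrow> real) \<Rightarrow> 'a set \<Rightarrow> 'a \<Rightarrow> real" where
  "restrict_to f E \<equiv> (\<lambda>y. f y * indicator E y)"

definition bounded_oscillation_operator ::
    "'a measure \<Rightarrow> 'a set set \<Rightarrow> ('a set \<Rightarrow> 'a set) \<Rightarrow>
      (ennreal \<Rightarrow> ennreal) \<Rightarrow> (ennreal \<Rightarrow> ennreal) \<Rightarrow> (real \<Rightarrow> real) \<Rightarrow> (real \<Rightarrow> real) \<Rightarrow>
      (('a \<Rightarrow> real) \<Rightarrow> 'a \<Rightarrow> real) \<Rightarrow> bool" where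
  "bounded_oscillation_operator M \<BB> bhull \<Phi> \<Psi> \<phi> \<psi> T \<longleftrightarrow>
    (linear_operator_on (space M) (orlicz_morrey_space M \<BB> \<Psi> \<psi>) T \<or>
     sublinear_operator_on (space M) (orlicz_morrey_space M \<BB> \<Psi> \<psi>) T) \<and>
    (\<exists>C\<^sub>1 C\<^sub>2 :: real. 0 < C\<^sub>1 \<and> 0 < C\<^sub>2 \<and>
      (\<forall>f \<in> orlicz_morrey_space M \<BB> \<Psi> \<psi>.
        (\<forall>B\<^sub>0\<in>\<BB>. bhull B\<^sub>0 \<subset> space M \<longrightarrow>
          (\<exists>B\<in>\<BB>. B\<^sub>0 \<subset> B \<and>
            (SUP x\<in>B\<^sub>0. ennreal \<bar>T (restrict_to f (bhull B)) x - T (restrict_to f (bhull B\<^sub>0)) x\<bar>)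
              \<le> ennreal C\<^sub>1 * orlicz_morrey_local_norm M \<Phi> \<phi> (bhull B) f)) \<and>
        (\<forall>B\<in>\<BB>.
          (SUP (x, x')\<in>B \<times> B.
             ennreal \<bar>(T f x - T (restrict_to f (bhull B)) x)
                     - (T f x' - T (restrict_to f (bhull B)) x')\<bar>)
            \<le> ennreal C\<^sub>2 * orlicz_morrey_sup_norm M \<BB> \<Phi> \<phi> B f)))"

definition orlicz_morrey_maximal ::
    "'a measure \<Rightarrow> 'a set set \<Rightarrow> (ennreal \<Rightarrow> ennreal) \<Rightarrow> (real \<Rightarrow> real) \<Rightarrow> ('a \<Rightarrow> real) \<Rightarrow> 'a \<Rightarrow> ennreal"
  where
  "orlicz_morrey_maximal M \<BB> \<Phi> \<phi> f x =
    (if x \<in> \<Union>\<BB> then SUP B\<in>{B\<in>\<BB>. x \<in> B}. orlicz_morrey_local_norm M \<Phi> \<phi> B f else 0)"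

end

theory Submission
  imports Defs
begin

text \<open>
  Convexity of \<open>\<Phi>\<close> and almost monotonicity of \<open>\<phi>(r)\<close> and \<open>r \<phi>(r)\<close> show that, whenever
  \<open>\<mu>(B) \<le> D \<mu>(A)\<close>, the norm on the ball \<open>A\<close> of \<open>f\<close> cut off to \<open>B\<close> is at most a constant times the
  norm of \<open>f\<close> on \<open>B\<close>. Let \<open>x \<in> B\<^sub>0\<close>. A ball \<open>A \<ni> x\<close> with \<open>\<mu>(A) \<le> 2 \<mu>(B\<^sub>0)\<close> lies in the hull of
  \<open>B\<^sub>0\<close>, where cutting off \<open>f\<close> to that hull has no effect. A larger ball \<open>A\<close> has \<open>B\<^sub>0\<close> inside its own
  hull, which gives condition (II). For condition (I) take \<open>B\<close> to be the hull of a ball \<open>A\<close> meeting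
  \<open>B\<^sub>0\<close> with \<open>\<mu>(A) > 2 \<mu>(B\<^sub>0)\<close> whose measure is less than twice the infimum over all such balls; one
  exists, because otherwise (B2) would put every point of the space into the hull of \<open>B\<^sub>0\<close>.
\<close>

section \<open>Young functions and growth functions\<close>

lemma young_function_mult_le:
  assumes "young_function \<Phi>" "0 \<le> t" "t \<le> 1"
  shows "\<Phi> (ennreal t * a) \<le> ennreal t * \<Phi> a"
proof -
  have "\<Phi> (ennreal t * a + ennreal (1 - t) * 0) \<le> ennreal t * \<Phi> a + ennreal (1 - t) * \<Phi> 0"
    using assms unfolding young_function_def by blast
  then show ?thesis using assms by (simp add: young_function_def)
qed

text \<open>For finite positive arguments the smaller one is the larger one times a factor at most
  1, so convexity together with \<open>\<Phi> 0 = 0\<close> applies. The remaining cases are settled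
  by the prescribed values at 0 and \<infinity>.\<close>

lemma young_function_mono:
  assumes "young_function \<Phi>"
  shows "mono \<Phi>"
proof
  fix a b :: ennreal
  assume ab: "a \<le> b"
  show "\<Phi> a \<le> \<Phi> b"
  proof (cases "b = \<infinity> \<or> a = 0")
    case True
    then show ?thesis using assms by (auto simp: young_function_def)
  next
    case False
    obtain x y where xy: "a = ennreal x" "b = ennreal y" "0 < x" "x \<le> y"
      using ab False by (cases a; cases b) (auto simp: less_le top_unique)
    have a: "a = ennreal (x / y) * b"
      using xy by (simp flip: ennreal_mult')
    have "\<Phi> a \<le> ennreal (x / y) * \<Phi> b"
      unfolding a using xy by (intro young_function_mult_le assms) auto
    also have "\<dots> \<le> 1 * \<Phi> b"
      using xy by (intro mult_right_mono) auto
    finally show ?thesis by simp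
  qed
qed

text \<open>A sublevel set of a monotone function is closed downwards, hence an initial interval
  that either contains its supremum or omits it.\<close>

lemma borel_measurable_mono_ennreal:
  fixes f :: "ennreal \<Rightarrow> ennreal"
  assumes "mono f"
  shows "f \<in> borel_measurable borel"
proof (rule borel_measurableI_le)
  fix y
  define S where "S = {x. f x \<le> y}"
  have *: "x \<in> S" if "x < Sup S" for x
    using that monoD[OF assms] unfolding S_def less_Sup_iff
    by (metis (mono_tags, lifting) less_imp_le mem_Collect_eq order_trans)
  have "S = {..Sup S} \<or> S = {..<Sup S}"
  proof (cases "Sup S \<in> S")
    case True
    then show ?thesis using * by (auto simp: le_less intro: Sup_upper)
  next
    case False
    then show ?thesis using * by (auto simp: less_le intro: Sup_upper)
  qed
  then have "S \<in> sets borel"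
    by (metis atMost_borel lessThan_borel)
  then show "{x \<in> space borel. f x \<le> y} \<in> sets borel"
    by (simp add: S_def)
qed

lemma young_function_measurable:
  "young_function \<Phi> \<Longrightarrow> \<Phi> \<in> borel_measurable borel"
  by (intro borel_measurable_mono_ennreal young_function_mono)

lemma growth_class_pos: "\<phi> \<in> growth_class \<Longrightarrow> 0 < r \<Longrightarrow> 0 < \<phi> r"
  unfolding growth_class_def by blast

text \<open>This compares the weights \<open>r * \<phi> r\<close> of two balls when only one of the
  two ratios of their measures is bounded. For \<open>s \<le> r\<close> the almost increase of the
  weight suffices; for \<open>r < s\<close> the almost decrease of \<open>\<phi>\<close> bounds
  \<open>\<phi> s\<close>, and \<open>s \<le> D * r\<close> bounds the other factor.\<close>

lemma growth_class_mult_le: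
  assumes "\<phi> \<in> growth_class" "0 < D"
  obtains K where "1 \<le> K" "\<And>r s. 0 < r \<Longrightarrow> 0 < s \<Longrightarrow> s \<le> D * r \<Longrightarrow> s * \<phi> s \<le> K * (r * \<phi> r)"
proof -
  obtain C_dc C_ic where C: "0 < C_dc" "0 < C_ic"
    "\<And>r s. 0 < r \<Longrightarrow> r \<le> s \<Longrightarrow> C_dc * \<phi> s \<le> \<phi> r \<and> r * \<phi> r \<le> C_ic * (s * \<phi> s)"
    and pos: "\<And>r. 0 < r \<Longrightarrow> 0 < \<phi> r"
    using assms(1) unfolding growth_class_def by blast
  \<comment> \<open>The maximum with 1 makes \<open>1 / K\<close> a legitimate factor in the
    convexity inequality later on.\<close>
  define K where "K = max 1 (max C_ic (D / C_dc))"
  show ?thesis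
  proof
    show "1 \<le> K" by (simp add: K_def)
    fix r s :: real
    assume rs: "0 < r" "0 < s" "s \<le> D * r"
    have rpos: "0 \<le> r * \<phi> r" using rs pos by (simp add: less_imp_le)
    show "s * \<phi> s \<le> K * (r * \<phi> r)"
    proof (cases "s \<le> r")
      case True
      then have "s * \<phi> s \<le> C_ic * (r * \<phi> r)" using C(3)[of s r] rs by simp
      also have "\<dots> \<le> K * (r * \<phi> r)" using rpos by (intro mult_right_mono) (auto simp: K_def)
      finally show ?thesis .
    next
      case False
      then have "\<phi> s \<le> \<phi> r / C_dc" using C(1) C(3)[of r s] rs by (simp add: field_simps)
      then have "s * \<phi> s \<le> (D * r) * (\<phi> r / C_dc)"
        using rs pos[of s] by (intro mult_mono) auto
      also have "\<dots> = D / C_dc * (r * \<phi> r)" by simp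
      also have "\<dots> \<le> K * (r * \<phi> r)" using rpos by (intro mult_right_mono) (auto simp: K_def)
      finally show ?thesis .
    qed
  qed
qed

text \<open>Transfers one-sided estimates in \<open>[0,\<infinity>]\<close> to differences of real
  values. Finiteness of \<open>a\<close>, and with it of \<open>b\<close>, matters because
  \<open>enn2real\<close> sends \<infinity> to 0; the error \<open>t\<close> may be
  infinite.\<close>

lemma enn2real_diff_bounds:
  fixes a b t :: ennreal
  assumes "b \<le> a" "a < \<infinity>" "a \<le> b + t"
  shows "0 \<le> enn2real a - enn2real b" "ennreal (enn2real a - enn2real b) \<le> t"
proof -
  show "0 \<le> enn2real a - enn2real b"
    using assms by (simp add: enn2real_mono)
  show "ennreal (enn2real a - enn2real b) \<le> t"
  proof (cases t)
    case (real r)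
    then show ?thesis
      using assms by (cases a; cases b) (auto simp: top_unique simp flip: ennreal_plus)
  qed auto
qed

section \<open>Balls and their hulls, with real-valued measures\<close>

context ball_basis
begin

lemma ball_sets [measurable, simp]: "B \<in> \<BB> \<Longrightarrow> B \<in> sets M"
  using balls_measurable by blast

lemma emeasure_ball: "B \<in> \<BB> \<Longrightarrow> emeasure M B = ennreal (measure M B)"
  using measure_pos_finite[of B] by (intro emeasure_eq_ennreal_measure) auto

lemma measure_ball_pos: "B \<in> \<BB> \<Longrightarrow> 0 < measure M B"
  using measure_pos_finite[of B] by (auto simp: emeasure_ball)

lemma ball_nonempty: "B \<in> \<BB> \<Longrightarrow> B \<noteq> {}"
  using measure_ball_pos[of B] by auto

lemma measure_ball_mono: "A \<in> \<BB> \<Longrightarrow> B \<in> \<BB> \<Longrightarrow> A \<subseteq> B \<Longrightarrow> measure M A \<le> measure M B"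
  using emeasure_mono[of A B M] by (simp add: emeasure_ball)

lemma measure_hull_le: "B \<in> \<BB> \<Longrightarrow> measure M (bhull B) \<le> C\<^sub>0 * measure M B"
  using hull_measure[of B] const_ge_1
  by (simp add: emeasure_ball hull_ball flip: ennreal_mult)

lemma subset_hull:
  assumes "A \<in> \<BB>" "B \<in> \<BB>" "A \<inter> B \<noteq> {}" "measure M A \<le> 2 * measure M B"
  shows "A \<subseteq> bhull B"
proof -
  have "ennreal (measure M A) \<le> ennreal (2 * measure M B)"
    using assms by (intro ennreal_leI)
  then have "emeasure M A \<le> 2 * emeasure M B"
    using assms by (simp add: emeasure_ball ennreal_mult)
  then show ?thesis
    using hull_contains[of B] assms by blast
qed

lemma ball_subset_hull: "B \<in> \<BB> \<Longrightarrow> B \<subseteq> bhull B"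
  using subset_hull[of B B] ball_nonempty[of B] by (simp add: measure_nonneg)

section \<open>Local Orlicz-Morrey norms on balls\<close>

lemma local_norm_eq:
  assumes "B \<in> \<BB>" "\<phi> \<in> growth_class"
  shows "orlicz_morrey_local_norm M \<Phi> \<phi> B f =
    Inf {ennreal s | s. 0 < s \<and>
      (\<integral>\<^sup>+x\<in>B. \<Phi> (ennreal (\<bar>f x\<bar> / s)) \<partial>M) \<le> ennreal (measure M B * \<phi> (measure M B))}"
proof -
  have pos: "0 < measure M B * \<phi> (measure M B)"
    using assms measure_ball_pos growth_class_pos by simp
  \<comment> \<open>The weight is positive and finite, so it can be moved to the other side of the
    inequality.\<close>
  have "1 / (emeasure M B * ennreal (\<phi> (measure M B))) * I \<le> 1 \<longleftrightarrow>
      I \<le> ennreal (measure M B * \<phi> (measure M B))" for I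
  proof -
    define r where "r = measure M B * \<phi> (measure M B)"
    have "1 / (emeasure M B * ennreal (\<phi> (measure M B))) = 1 / ennreal r"
      using assms by (simp add: r_def emeasure_ball ennreal_mult')
    also have "\<dots> = ennreal (1 / r)"
      using divide_ennreal[of 1 r] pos by (simp add: r_def)
    finally show ?thesis
      using pos unfolding r_def[symmetric]
      by (cases I) (auto simp: ennreal_mult_top top_unique field_simps simp flip: ennreal_mult)
  qed
  then show ?thesis
    by (simp add: orlicz_morrey_local_norm_def)
qed

text \<open>If \<open>s\<close> is admissible for \<open>g\<close> on \<open>B'\<close>, then
  \<open>c * K * s\<close> is admissible for \<open>f\<close> on \<open>B\<close>: hypothesis
  \<open>le\<close> handles the factor \<open>c\<close>, and convexity pulls \<open>1 / K\<close>
  out of \<open>\<Phi>\<close>, which pays for the ratio \<open>K\<close> of the weights.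
  Monotonicity, homogeneity, cutting off to a ball and the passage from \<open>\<Psi>\<close> to
  \<open>\<Phi>\<close> are all instances.\<close>

lemma local_norm_compare:
  assumes B: "B \<in> \<BB>" "B' \<in> \<BB>" "\<phi> \<in> growth_class" "\<psi> \<in> growth_class"
    and \<Phi>: "young_function \<Phi>" and f [measurable]: "f \<in> borel_measurable M"
    and c: "0 < c" and K: "1 \<le> K"
    and weight: "measure M B' * \<psi> (measure M B') \<le> K * (measure M B * \<phi> (measure M B))"
    and le: "\<And>s. 0 < s \<Longrightarrow> (\<integral>\<^sup>+x\<in>B. \<Phi> (ennreal (\<bar>f x\<bar> / (c * s))) \<partial>M) \<le>
        (\<integral>\<^sup>+x\<in>B'. \<Psi> (ennreal (\<bar>g x\<bar> / s)) \<partial>M)"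
  shows "orlicz_morrey_local_norm M \<Phi> \<phi> B f \<le>
    ennreal (c * K) * orlicz_morrey_local_norm M \<Psi> \<psi> B' g"
proof -
  note [measurable] = young_function_measurable[OF \<Phi>] B(1)[THEN ball_sets]
  \<comment> \<open>With the constant moved to the left, the right side is a plain infimum and the
    bound can be tested on each admissible \<open>s\<close>.\<close>
  have "ennreal (1 / (c * K)) * orlicz_morrey_local_norm M \<Phi> \<phi> B f \<le>
      orlicz_morrey_local_norm M \<Psi> \<psi> B' g"
    unfolding local_norm_eq[OF B(2,4)]
  proof (safe intro!: Inf_greatest)
    fix s :: real
    assume s: "0 < s" and adm: "(\<integral>\<^sup>+x\<in>B'. \<Psi> (ennreal (\<bar>g x\<bar> / s)) \<partial>M)
        \<le> ennreal (measure M B' * \<psi> (measure M B'))"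
    have "(\<integral>\<^sup>+x\<in>B. \<Phi> (ennreal (\<bar>f x\<bar> / (c * K * s))) \<partial>M) \<le>
        (\<integral>\<^sup>+x. ennreal (1 / K) * (\<Phi> (ennreal (\<bar>f x\<bar> / (c * s))) * indicator B x) \<partial>M)"
    proof (rule nn_integral_mono)
      fix x
      have "ennreal (\<bar>f x\<bar> / (c * K * s)) = ennreal (1 / K) * ennreal (\<bar>f x\<bar> / (c * s))"
        using c K s by (simp add: mult_ac flip: ennreal_mult')
      then have "\<Phi> (ennreal (\<bar>f x\<bar> / (c * K * s))) \<le> ennreal (1 / K) * \<Phi> (ennreal (\<bar>f x\<bar> / (c * s)))"
        using young_function_mult_le[OF \<Phi>, of "1 / K"] K by simp
      then show "\<Phi> (ennreal (\<bar>f x\<bar> / (c * K * s))) * indicator B x \<le>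
          ennreal (1 / K) * (\<Phi> (ennreal (\<bar>f x\<bar> / (c * s))) * indicator B x)"
        by (auto simp: indicator_def)
    qed
    also have "\<dots> = ennreal (1 / K) * (\<integral>\<^sup>+x\<in>B. \<Phi> (ennreal (\<bar>f x\<bar> / (c * s))) \<partial>M)"
      by (rule nn_integral_cmult) measurable
    also have "\<dots> \<le> ennreal (1 / K) * ennreal (K * (measure M B * \<phi> (measure M B)))"
      by (intro mult_left_mono order_trans[OF le[OF s]] order_trans[OF adm] ennreal_leI weight) simp
    also have "\<dots> = ennreal (measure M B * \<phi> (measure M B))"
      using K by (simp flip: ennreal_mult')
    finally have "orlicz_morrey_local_norm M \<Phi> \<phi> B f \<le> ennreal (c * K * s)"
      unfolding local_norm_eq[OF B(1,3)] using c K s by (intro Inf_lower) auto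
    then have "ennreal (1 / (c * K)) * orlicz_morrey_local_norm M \<Phi> \<phi> B f \<le>
        ennreal (1 / (c * K)) * ennreal (c * K * s)"
      by (intro mult_left_mono) auto
    also have "\<dots> = ennreal s"
      using c K by (simp flip: ennreal_mult')
    finally show "ennreal (1 / (c * K)) * orlicz_morrey_local_norm M \<Phi> \<phi> B f \<le> ennreal s" .
  qed
  then have "ennreal (c * K) * (ennreal (1 / (c * K)) * orlicz_morrey_local_norm M \<Phi> \<phi> B f) \<le>
      ennreal (c * K) * orlicz_morrey_local_norm M \<Psi> \<psi> B' g"
    by (intro mult_left_mono) auto
  moreover have "ennreal (c * K) * ennreal (1 / (c * K)) = 1"
    using c K by (simp flip: ennreal_mult')
  ultimately show ?thesis
    by (simp add: mult.assoc[symmetric])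
qed

lemma local_norm_mono:
  assumes "B \<in> \<BB>" "\<phi> \<in> growth_class" "young_function \<Phi>" "f \<in> borel_measurable M"
    and "\<And>x. x \<in> B \<Longrightarrow> \<bar>f x\<bar> \<le> \<bar>g x\<bar>"
  shows "orlicz_morrey_local_norm M \<Phi> \<phi> B f \<le> orlicz_morrey_local_norm M \<Phi> \<phi> B g"
proof -
  have "orlicz_morrey_local_norm M \<Phi> \<phi> B f \<le> ennreal (1 * 1) * orlicz_morrey_local_norm M \<Phi> \<phi> B g"
  proof (rule local_norm_compare[OF assms(1,1,2,2,3,4)])
    fix s :: real
    assume s: "0 < s"
    have "\<Phi> (ennreal (\<bar>f x\<bar> / (1 * s))) \<le> \<Phi> (ennreal (\<bar>g x\<bar> / s))" if "x \<in> B" for x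
      using assms(5)[OF that] s
      by (intro monoD[OF young_function_mono[OF assms(3)]] ennreal_leI) (simp add: divide_right_mono)
    then show "(\<integral>\<^sup>+x\<in>B. \<Phi> (ennreal (\<bar>f x\<bar> / (1 * s))) \<partial>M) \<le>
        (\<integral>\<^sup>+x\<in>B. \<Phi> (ennreal (\<bar>g x\<bar> / s)) \<partial>M)"
      by (intro nn_integral_mono) (simp add: indicator_def)
  qed simp_all
  then show ?thesis by simp
qed

text \<open>The classical Luxemburg norm argument: if \<open>s\<close> and \<open>t\<close> are
  admissible for \<open>f\<close> and \<open>g\<close>, then \<open>s + t\<close> is admissible for
  the sum, because \<open>(\<bar>f\<bar> + \<bar>g\<bar>) / (s + t)\<close> is the convex
  combination of \<open>\<bar>f\<bar> / s\<close> and \<open>\<bar>g\<bar> / t\<close> with weights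
  \<open>s / (s + t)\<close> and \<open>t / (s + t)\<close>.\<close>

lemma local_norm_triangle:
  assumes B: "B \<in> \<BB>" "\<phi> \<in> growth_class" and \<Phi>: "young_function \<Phi>"
    and [measurable]: "f \<in> borel_measurable M" "g \<in> borel_measurable M"
  shows "orlicz_morrey_local_norm M \<Phi> \<phi> B (\<lambda>x. f x + g x) \<le>
    orlicz_morrey_local_norm M \<Phi> \<phi> B f + orlicz_morrey_local_norm M \<Phi> \<phi> B g"
proof -
  note [measurable] = young_function_measurable[OF \<Phi>] B(1)[THEN ball_sets]
  define w where "w = ennreal (measure M B * \<phi> (measure M B))"
  define I where "I f s = (\<integral>\<^sup>+x\<in>B. \<Phi> (ennreal (\<bar>f x\<bar> / s)) \<partial>M)" for f :: "'a \<Rightarrow> real" and s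
  have N: "orlicz_morrey_local_norm M \<Phi> \<phi> B f = Inf {ennreal s | s. 0 < s \<and> I f s \<le> w}" for f
    unfolding local_norm_eq[OF B] I_def w_def ..
  have "orlicz_morrey_local_norm M \<Phi> \<phi> B (\<lambda>x. f x + g x) \<le> ennreal (s + t)"
    if st: "0 < s" "0 < t" "I f s \<le> w" "I g t \<le> w" for s t
  proof -
    define a where "a = s / (s + t)"
    have a: "0 \<le> a" "a \<le> 1" using st by (auto simp: a_def)
    have "I (\<lambda>x. f x + g x) (s + t) \<le>
        (\<integral>\<^sup>+x. ennreal a * (\<Phi> (ennreal (\<bar>f x\<bar> / s)) * indicator B x) +
             ennreal (1 - a) * (\<Phi> (ennreal (\<bar>g x\<bar> / t)) * indicator B x) \<partial>M)"
      unfolding I_def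
    proof (rule nn_integral_mono)
      fix x
      have "\<bar>f x + g x\<bar> / (s + t) \<le> (\<bar>f x\<bar> + \<bar>g x\<bar>) / (s + t)"
        using st by (intro divide_right_mono) auto
      also have "\<dots> = a * (\<bar>f x\<bar> / s) + (1 - a) * (\<bar>g x\<bar> / t)"
      proof -
        have "1 - a = t / (s + t)" using st by (simp add: a_def field_simps)
        then show ?thesis using st by (simp add: a_def add_divide_distrib)
      qed
      finally have "ennreal (\<bar>f x + g x\<bar> / (s + t)) \<le>
          ennreal (a * (\<bar>f x\<bar> / s) + (1 - a) * (\<bar>g x\<bar> / t))"
        by (rule ennreal_leI)
      also have "\<dots> = ennreal a * ennreal (\<bar>f x\<bar> / s) + ennreal (1 - a) * ennreal (\<bar>g x\<bar> / t)"
        using a st by (simp add: ennreal_plus ennreal_mult del: times_divide_eq_right)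
      finally have "\<Phi> (ennreal (\<bar>f x + g x\<bar> / (s + t))) \<le> \<Phi> \<dots>"
        by (rule monoD[OF young_function_mono[OF \<Phi>]])
      also have "\<dots> \<le> ennreal a * \<Phi> (ennreal (\<bar>f x\<bar> / s)) + ennreal (1 - a) * \<Phi> (ennreal (\<bar>g x\<bar> / t))"
        using \<Phi> a unfolding young_function_def by blast
      finally show "\<Phi> (ennreal (\<bar>f x + g x\<bar> / (s + t))) * indicator B x \<le>
          ennreal a * (\<Phi> (ennreal (\<bar>f x\<bar> / s)) * indicator B x) +
          ennreal (1 - a) * (\<Phi> (ennreal (\<bar>g x\<bar> / t)) * indicator B x)"
        by (auto simp: indicator_def)
    qed
    also have "\<dots> = ennreal a * I f s + ennreal (1 - a) * I g t"
      unfolding I_def by (subst nn_integral_add) (auto simp: nn_integral_cmult)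
    also have "\<dots> \<le> ennreal a * w + ennreal (1 - a) * w"
      using st by (intro add_mono mult_left_mono) auto
    also have "\<dots> = w"
      using a by (simp flip: distrib_right ennreal_plus)
    finally show ?thesis
      unfolding N using st by (intro Inf_lower) (auto simp del: ennreal_plus)
  qed
  then have *: "orlicz_morrey_local_norm M \<Phi> \<phi> B (\<lambda>x. f x + g x) \<le> ennreal s + ennreal t"
    if "0 < s" "0 < t" "I f s \<le> w" "I g t \<le> w" for s t
    using that by (simp add: ennreal_plus)
  \<comment> \<open>A finite infimum becomes strictly larger when \<open>e\<close> is added, so some
    admissible number lies below the result.\<close>
  have ex: "\<exists>s. 0 < s \<and> I h s \<le> w \<and> ennreal s < orlicz_morrey_local_norm M \<Phi> \<phi> B h + ennreal e"
    if "orlicz_morrey_local_norm M \<Phi> \<phi> B h < \<infinity>" "0 < e" for h and e :: real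
  proof -
    have "orlicz_morrey_local_norm M \<Phi> \<phi> B h < orlicz_morrey_local_norm M \<Phi> \<phi> B h + ennreal e"
      using that by (cases "orlicz_morrey_local_norm M \<Phi> \<phi> B h") (auto simp flip: ennreal_plus simp: ennreal_less_iff)
    from this[unfolded N[of h] Inf_less_iff] show ?thesis
      unfolding N[of h] by blast
  qed
  show ?thesis
  proof (rule ennreal_le_epsilon)
    fix e :: real
    assume fin: "orlicz_morrey_local_norm M \<Phi> \<phi> B f + orlicz_morrey_local_norm M \<Phi> \<phi> B g < top" and e: "0 < e"
    obtain s where s: "0 < s" "I f s \<le> w" "ennreal s < orlicz_morrey_local_norm M \<Phi> \<phi> B f + ennreal (e / 2)"
      using ex[of f "e / 2"] fin e by auto
    obtain t where t: "0 < t" "I g t \<le> w" "ennreal t < orlicz_morrey_local_norm M \<Phi> \<phi> B g + ennreal (e / 2)"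
      using ex[of g "e / 2"] fin e by auto
    have "orlicz_morrey_local_norm M \<Phi> \<phi> B (\<lambda>x. f x + g x) \<le> ennreal s + ennreal t"
      using * s t by blast
    also have "\<dots> \<le> (orlicz_morrey_local_norm M \<Phi> \<phi> B f + ennreal (e / 2)) +
        (orlicz_morrey_local_norm M \<Phi> \<phi> B g + ennreal (e / 2))"
      using s t by (intro add_mono) auto
    also have "\<dots> = orlicz_morrey_local_norm M \<Phi> \<phi> B f + orlicz_morrey_local_norm M \<Phi> \<phi> B g +
        (ennreal (e / 2) + ennreal (e / 2))"
      by (simp only: ac_simps)
    also have "ennreal (e / 2) + ennreal (e / 2) = ennreal e"
      using e by (simp flip: ennreal_plus)
    finally show "orlicz_morrey_local_norm M \<Phi> \<phi> B (\<lambda>x. f x + g x) \<le>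
        orlicz_morrey_local_norm M \<Phi> \<phi> B f + orlicz_morrey_local_norm M \<Phi> \<phi> B g + ennreal e" .
  qed
qed

text \<open>The integrand of \<open>c * f\<close> at level \<open>\<bar>c\<bar> * s\<close> is that
  of \<open>f\<close> at level \<open>s\<close>. The value \<open>c = 0\<close> is excluded since
  \<open>\<bar>c\<bar>\<close> serves as a positive scaling constant.\<close>

lemma local_norm_cmult_le:
  assumes "B \<in> \<BB>" "\<phi> \<in> growth_class" "young_function \<Phi>" "f \<in> borel_measurable M" "c \<noteq> 0"
  shows "orlicz_morrey_local_norm M \<Phi> \<phi> B (\<lambda>x. c * f x) \<le>
    ennreal \<bar>c\<bar> * orlicz_morrey_local_norm M \<Phi> \<phi> B f"
proof -
  have "orlicz_morrey_local_norm M \<Phi> \<phi> B (\<lambda>x. c * f x) \<le>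
    ennreal (\<bar>c\<bar> * 1) * orlicz_morrey_local_norm M \<Phi> \<phi> B f"
    by (rule local_norm_compare[OF assms(1,1,2,2,3)]) (use assms in \<open>simp_all add: abs_mult\<close>)
  then show ?thesis by simp
qed

lemma local_norm_zero:
  assumes "B \<in> \<BB>" "\<phi> \<in> growth_class" "young_function \<Phi>"
  shows "orlicz_morrey_local_norm M \<Phi> \<phi> B (\<lambda>x. 0) = 0"
proof -
  have "orlicz_morrey_local_norm M \<Phi> \<phi> B (\<lambda>x. 0) \<le> 0 + ennreal e" if "0 < e" for e
    unfolding local_norm_eq[OF assms(1,2)]
    using assms(3) that by (intro Inf_lower) (auto simp: young_function_def)
  then show ?thesis
    using ennreal_le_epsilon[of 0 "orlicz_morrey_local_norm M \<Phi> \<phi> B (\<lambda>x. 0)"] by simp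
qed

lemma local_norm_cmult:
  assumes "B \<in> \<BB>" "\<phi> \<in> growth_class" "young_function \<Phi>" "f \<in> borel_measurable M"
  shows "orlicz_morrey_local_norm M \<Phi> \<phi> B (\<lambda>x. c * f x) =
    ennreal \<bar>c\<bar> * orlicz_morrey_local_norm M \<Phi> \<phi> B f"
proof (cases "c = 0")
  case True
  then show ?thesis using assms by (simp add: local_norm_zero)
next
  case False
  show ?thesis
  proof (rule antisym[OF local_norm_cmult_le[OF assms False]])
    \<comment> \<open>The reverse inequality is the same bound for the factor \<open>1 / c\<close>
      applied to \<open>c * f\<close>.\<close>
    have "orlicz_morrey_local_norm M \<Phi> \<phi> B (\<lambda>x. (1 / c) * (c * f x)) \<le>
        ennreal \<bar>1 / c\<bar> * orlicz_morrey_local_norm M \<Phi> \<phi> B (\<lambda>x. c * f x)"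
      using assms False by (intro local_norm_cmult_le) auto
    then have "ennreal \<bar>c\<bar> * orlicz_morrey_local_norm M \<Phi> \<phi> B f \<le>
        ennreal \<bar>c\<bar> * (ennreal \<bar>1 / c\<bar> * orlicz_morrey_local_norm M \<Phi> \<phi> B (\<lambda>x. c * f x))"
      using False by (intro mult_left_mono) simp_all
    also have "\<dots> = orlicz_morrey_local_norm M \<Phi> \<phi> B (\<lambda>x. c * f x)"
    proof -
      have "ennreal \<bar>c\<bar> * ennreal \<bar>1 / c\<bar> = 1"
        using False by (simp flip: ennreal_mult)
      then show ?thesis by (simp only: mult_1 flip: mult.assoc)
    qed
    finally show "ennreal \<bar>c\<bar> * orlicz_morrey_local_norm M \<Phi> \<phi> B f \<le>
        orlicz_morrey_local_norm M \<Phi> \<phi> B (\<lambda>x. c * f x)" .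
  qed
qed

text \<open>Since \<open>\<Phi> 0 = 0\<close>, the integrand of the cut-off function vanishes
  outside \<open>B\<close>, so its integral over \<open>A\<close> is at most the integral of the
  original over \<open>B\<close>. Only the ratio of the two weights remains, and its bound
  \<open>K\<close> depends neither on the balls nor on \<open>f\<close>.\<close>

lemma local_norm_restrict_le:
  assumes "\<phi> \<in> growth_class" "young_function \<Phi>" "0 < D"
  obtains K where "1 \<le> K"
    "\<And>A B f. A \<in> \<BB> \<Longrightarrow> B \<in> \<BB> \<Longrightarrow> measure M B \<le> D * measure M A \<Longrightarrow> f \<in> borel_measurable M \<Longrightarrow>
      orlicz_morrey_local_norm M \<Phi> \<phi> A (restrict_to f B) \<le>
        ennreal K * orlicz_morrey_local_norm M \<Phi> \<phi> B f"
proof -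
  obtain K where K: "1 \<le> K"
    "\<And>r s. 0 < r \<Longrightarrow> 0 < s \<Longrightarrow> s \<le> D * r \<Longrightarrow> s * \<phi> s \<le> K * (r * \<phi> r)"
    using growth_class_mult_le[OF assms(1,3)] by blast
  show ?thesis
  proof (rule that[OF K(1)])
    fix A B and f :: "'a \<Rightarrow> real"
    assume A: "A \<in> \<BB>" and B: "B \<in> \<BB>" and D: "measure M B \<le> D * measure M A"
      and f: "f \<in> borel_measurable M"
    have "orlicz_morrey_local_norm M \<Phi> \<phi> A (restrict_to f B) \<le>
        ennreal (1 * K) * orlicz_morrey_local_norm M \<Phi> \<phi> B f"
    proof (rule local_norm_compare[OF A B assms(1,1,2)])
      show "restrict_to f B \<in> borel_measurable M" using f B by simp
      show "measure M B * \<phi> (measure M B) \<le> K * (measure M A * \<phi> (measure M A))"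
        using A B D measure_ball_pos K(2) by blast
      fix s :: real
      show "(\<integral>\<^sup>+x\<in>A. \<Phi> (ennreal (\<bar>f x * indicator B x\<bar> / (1 * s))) \<partial>M) \<le>
          (\<integral>\<^sup>+x\<in>B. \<Phi> (ennreal (\<bar>f x\<bar> / s)) \<partial>M)"
        using assms(2) by (intro nn_integral_mono) (auto simp: indicator_def young_function_def)
    qed (use K in auto)
    then show "orlicz_morrey_local_norm M \<Phi> \<phi> A (restrict_to f B) \<le>
        ennreal K * orlicz_morrey_local_norm M \<Phi> \<phi> B f"
      by simp
  qed
qed

text \<open>The constant in \<open>\<Phi> t \<le> \<Psi> (C * t)\<close> becomes the scaling
  constant of the comparison, and the one in \<open>\<psi> \<le> C' * \<phi>\<close>, raised to at
  least 1, becomes the ratio of the weights.\<close>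

lemma local_norm_dominated:
  assumes "young_growth_quadruple \<Phi> \<Psi> \<phi> \<psi>"
  obtains K where "\<And>B f. B \<in> \<BB> \<Longrightarrow> f \<in> borel_measurable M \<Longrightarrow>
      orlicz_morrey_local_norm M \<Phi> \<phi> B f \<le> ennreal K * orlicz_morrey_local_norm M \<Psi> \<psi> B f"
proof -
  from assms have \<Phi>: "young_function \<Phi>" and growth: "\<phi> \<in> growth_class" "\<psi> \<in> growth_class"
    unfolding young_growth_quadruple_def young_class_def by blast+
  from assms obtain C C' where C: "0 < C" "\<forall>t. \<Phi> t \<le> \<Psi> (ennreal C * t)"
    and C': "0 < C'" "\<forall>t>0. \<psi> t \<le> C' * \<phi> t"
    unfolding young_growth_quadruple_def by blast
  show ?thesis
  proof
    fix B and f :: "'a \<Rightarrow> real"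
    assume B: "B \<in> \<BB>" and f: "f \<in> borel_measurable M"
    let ?m = "measure M B"
    show "orlicz_morrey_local_norm M \<Phi> \<phi> B f \<le>
        ennreal (C * max 1 C') * orlicz_morrey_local_norm M \<Psi> \<psi> B f"
    proof (rule local_norm_compare[OF B B growth \<Phi> f C(1)])
      have pos: "0 < ?m" "0 < \<phi> ?m"
        using measure_ball_pos[OF B] growth_class_pos[OF growth(1)] by auto
      have "\<psi> ?m \<le> max 1 C' * \<phi> ?m"
        using C'(2)[rule_format, OF pos(1)] pos mult_right_mono[of C' "max 1 C'" "\<phi> ?m"] by linarith
      then show "?m * \<psi> ?m \<le> max 1 C' * (?m * \<phi> ?m)"
        using pos by (simp add: mult.left_commute)
      fix s :: real
      assume s: "0 < s"
      have "\<Phi> (ennreal (\<bar>f x\<bar> / (C * s))) \<le> \<Psi> (ennreal (\<bar>f x\<bar> / s))" for x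
      proof -
        have "ennreal C * ennreal (\<bar>f x\<bar> / (C * s)) = ennreal (\<bar>f x\<bar> / s)"
          using C(1) s by (simp flip: ennreal_mult)
        then show ?thesis using C(2)[rule_format, of "ennreal (\<bar>f x\<bar> / (C * s))"] by simp
      qed
      then show "(\<integral>\<^sup>+x\<in>B. \<Phi> (ennreal (\<bar>f x\<bar> / (C * s))) \<partial>M) \<le>
          (\<integral>\<^sup>+x\<in>B. \<Psi> (ennreal (\<bar>f x\<bar> / s)) \<partial>M)"
        by (intro nn_integral_mono mult_right_mono) auto
    qed simp
  qed
qed

section \<open>The maximal operator with values in \<open>[0,\<infinity>]\<close>\<close>

lemma maximal_eq_SUP:
  assumes "x \<in> space M"
  shows "orlicz_morrey_maximal M \<BB> \<Phi> \<phi> f x =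
    (SUP B\<in>{B\<in>\<BB>. x \<in> B}. orlicz_morrey_local_norm M \<Phi> \<phi> B f)"
  \<comment> \<open>(B2) with both points equal to \<open>x\<close> yields a ball around
    \<open>x\<close>, so the default value 0 does not occur here.\<close>
  using common_ball[OF assms assms] by (auto simp: orlicz_morrey_maximal_def)

lemma local_norm_le_maximal:
  "A \<in> \<BB> \<Longrightarrow> x \<in> A \<Longrightarrow> orlicz_morrey_local_norm M \<Phi> \<phi> A f \<le> orlicz_morrey_maximal M \<BB> \<Phi> \<phi> f x"
  by (auto simp: orlicz_morrey_maximal_def intro!: SUP_upper)

lemma maximal_le:
  "(\<And>A. A \<in> \<BB> \<Longrightarrow> x \<in> A \<Longrightarrow> orlicz_morrey_local_norm M \<Phi> \<phi> A f \<le> c) \<Longrightarrow>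
    orlicz_morrey_maximal M \<BB> \<Phi> \<phi> f x \<le> c"
  by (auto simp: orlicz_morrey_maximal_def intro!: SUP_least)

lemma maximal_mono:
  assumes "\<phi> \<in> growth_class" "young_function \<Phi>" "f \<in> borel_measurable M" "\<And>y. \<bar>f y\<bar> \<le> \<bar>g y\<bar>"
  shows "orlicz_morrey_maximal M \<BB> \<Phi> \<phi> f x \<le> orlicz_morrey_maximal M \<BB> \<Phi> \<phi> g x"
  by (rule maximal_le, rule order_trans[OF local_norm_mono local_norm_le_maximal]) (use assms in auto)

lemma maximal_triangle:
  assumes "\<phi> \<in> growth_class" "young_function \<Phi>" "f \<in> borel_measurable M" "g \<in> borel_measurable M"
  shows "orlicz_morrey_maximal M \<BB> \<Phi> \<phi> (\<lambda>y. f y + g y) x \<le>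
    orlicz_morrey_maximal M \<BB> \<Phi> \<phi> f x + orlicz_morrey_maximal M \<BB> \<Phi> \<phi> g x"
  using assms
  by (intro maximal_le order_trans[OF local_norm_triangle] add_mono local_norm_le_maximal)

lemma maximal_cmult:
  assumes "\<phi> \<in> growth_class" "young_function \<Phi>" "f \<in> borel_measurable M" "x \<in> space M"
  shows "orlicz_morrey_maximal M \<BB> \<Phi> \<phi> (\<lambda>y. c * f y) x =
    ennreal \<bar>c\<bar> * orlicz_morrey_maximal M \<BB> \<Phi> \<phi> f x"
  using assms by (simp add: maximal_eq_SUP local_norm_cmult SUP_mult_left_ennreal)

text \<open>Each local \<open>\<Phi>\<close>-norm is at most a constant times the local
  \<open>\<Psi>\<close>-norm, hence a constant times the global norm of \<open>f\<close>. This makes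
  the operator real-valued.\<close>

lemma maximal_finite:
  assumes "young_growth_quadruple \<Phi> \<Psi> \<phi> \<psi>" "f \<in> orlicz_morrey_space M \<BB> \<Psi> \<psi>"
  shows "orlicz_morrey_maximal M \<BB> \<Phi> \<phi> f x < \<infinity>"
proof -
  obtain K where K: "\<And>B f. B \<in> \<BB> \<Longrightarrow> f \<in> borel_measurable M \<Longrightarrow>
      orlicz_morrey_local_norm M \<Phi> \<phi> B f \<le> ennreal K * orlicz_morrey_local_norm M \<Psi> \<psi> B f"
    using local_norm_dominated[OF assms(1)] by blast
  from assms(2) have f: "f \<in> borel_measurable M" and fin: "orlicz_morrey_norm M \<BB> \<Psi> \<psi> f < \<infinity>"
    by (auto simp: orlicz_morrey_space_def L1_loc_def)
  have "orlicz_morrey_maximal M \<BB> \<Phi> \<phi> f x \<le> ennreal K * orlicz_morrey_norm M \<BB> \<Psi> \<psi> f"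
    unfolding orlicz_morrey_norm_def
    by (intro maximal_le order_trans[OF K] mult_left_mono SUP_upper f) auto
  also have "\<dots> < \<infinity>"
    using fin by (simp add: ennreal_mult_less_top)
  finally show ?thesis .
qed

end

section \<open>Finiteness, sublinearity and the two oscillation conditions\<close>

theorem theorem2p1:
  fixes M :: "'a measure" and \<BB> :: "'a set set" and bhull :: "'a set \<Rightarrow> 'a set" and C\<^sub>0 :: real
    and \<Phi> \<Psi> :: "ennreal \<Rightarrow> ennreal" and \<phi> \<psi> :: "real \<Rightarrow> real"
  assumes "young_growth_quadruple \<Phi> \<Psi> \<phi> \<psi>"
    and "ball_basis M \<BB> bhull C\<^sub>0"
  shows "(\<forall>f\<in>orlicz_morrey_space M \<BB> \<Psi> \<psi>. \<forall>x\<in>space M. orlicz_morrey_maximal M \<BB> \<Phi> \<phi> f x < \<infinity>) \<and>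
    bounded_oscillation_operator M \<BB> bhull \<Phi> \<Psi> \<phi> \<psi>
      (\<lambda>f x. enn2real (orlicz_morrey_maximal M \<BB> \<Phi> \<phi> f x))"
proof -
  interpret ball_basis M \<BB> bhull C\<^sub>0 by (rule assms(2))
  have \<Phi>: "young_function \<Phi>" and growth: "\<phi> \<in> growth_class"
    using assms(1) unfolding young_growth_quadruple_def young_class_def by blast+
  have C0: "1 \<le> C\<^sub>0" by (rule const_ge_1)
  let ?V = "orlicz_morrey_space M \<BB> \<Psi> \<psi>"
  let ?N = "orlicz_morrey_local_norm M \<Phi> \<phi>"
  let ?M = "orlicz_morrey_maximal M \<BB> \<Phi> \<phi>"
  \<comment> \<open>On the space \<open>?V\<close> the conversion loses nothing, because the maximal
    function is finite there.\<close>
  let ?T = "\<lambda>f x. enn2real (?M f x)"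
  have meas: "f \<in> borel_measurable M" if "f \<in> ?V" for f
    using that by (auto simp: orlicz_morrey_space_def L1_loc_def)
  have fin: "?M f x < \<infinity>" if "f \<in> ?V" for f x
    using maximal_finite[OF assms(1) that] .
  \<comment> \<open>Enlarging the cut-off set raises the maximal function, so the difference in
    condition (I) is nonnegative.\<close>
  have mono: "?M (restrict_to f A) x \<le> ?M (restrict_to f B) x"
    if "f \<in> ?V" "A \<in> \<BB>" "A \<subseteq> B" for f A B x
    using that meas by (intro maximal_mono growth \<Phi>) (auto simp: indicator_def)
  have sub: "sublinear_operator_on (space M) ?V ?T"
    unfolding sublinear_operator_on_def
  proof safe
    fix f g x
    assume fg: "f \<in> ?V" "g \<in> ?V"
    have "?T (\<lambda>y. f y + g y) x \<le> enn2real (?M f x + ?M g x)"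
      using fg fin by (intro enn2real_mono maximal_triangle growth \<Phi> meas) auto
    also have "\<dots> = ?T f x + ?T g x"
      using fg fin by (intro enn2real_plus) auto
    finally show "\<bar>?T (\<lambda>y. f y + g y) x\<bar> \<le> \<bar>?T f x\<bar> + \<bar>?T g x\<bar>" by simp
  next
    fix f x and c :: real
    assume "f \<in> ?V" "x \<in> space M"
    then show "\<bar>?T (\<lambda>y. c * f y) x\<bar> = \<bar>c\<bar> * \<bar>?T f x\<bar>"
      using growth \<Phi> meas by (simp add: maximal_cmult enn2real_mult)
  qed
  \<comment> \<open>In condition (I) the outer hull is the hull of a hull, which costs
    \<open>C\<^sub>0\<^sup>2\<close>; the 2 comes from choosing a ball of nearly minimal measure.
    Both \<open>K\<^sub>1\<close> and \<open>K\<^sub>2\<close> are fixed before \<open>f\<close> and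
    the balls.\<close>
  have "0 < 2 * C\<^sub>0\<^sup>2" using C0 by simp
  from local_norm_restrict_le[OF growth \<Phi> this] obtain K\<^sub>1 where K1: "1 \<le> K\<^sub>1"
    "\<And>A B f. A \<in> \<BB> \<Longrightarrow> B \<in> \<BB> \<Longrightarrow> measure M B \<le> 2 * C\<^sub>0\<^sup>2 * measure M A \<Longrightarrow> f \<in> borel_measurable M \<Longrightarrow>
      ?N A (restrict_to f B) \<le> ennreal K\<^sub>1 * ?N B f"
    by blast
  \<comment> \<open>Condition (II) only passes from a ball to its own hull, which costs a single
    \<open>C\<^sub>0\<close>.\<close>
  have "0 < C\<^sub>0" using C0 by simp
  from local_norm_restrict_le[OF growth \<Phi> this] obtain K\<^sub>2 where K2: "1 \<le> K\<^sub>2"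
    "\<And>A B f. A \<in> \<BB> \<Longrightarrow> B \<in> \<BB> \<Longrightarrow> measure M B \<le> C\<^sub>0 * measure M A \<Longrightarrow> f \<in> borel_measurable M \<Longrightarrow>
      ?N A (restrict_to f B) \<le> ennreal K\<^sub>2 * ?N B f"
    by blast
  have I: "\<exists>B\<in>\<BB>. B\<^sub>0 \<subset> B \<and>
      (SUP x\<in>B\<^sub>0. ennreal \<bar>?T (restrict_to f (bhull B)) x - ?T (restrict_to f (bhull B\<^sub>0)) x\<bar>)
        \<le> ennreal K\<^sub>1 * ?N (bhull B) f"
    if f: "f \<in> ?V" and B0: "B\<^sub>0 \<in> \<BB>" "bhull B\<^sub>0 \<subset> space M" for f B\<^sub>0
  proof -
    \<comment> \<open>These are the balls meeting \<open>B\<^sub>0\<close> that are too large for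
      the hull property of \<open>B\<^sub>0\<close>.\<close>
    define S where "S = {A \<in> \<BB>. A \<inter> B\<^sub>0 \<noteq> {} \<and> 2 * measure M B\<^sub>0 < measure M A}"
    have "S \<noteq> {}"
    proof
      assume "S = {}"
      obtain x y where "x \<in> B\<^sub>0" "y \<in> space M" "y \<notin> bhull B\<^sub>0"
        using ball_nonempty B0 by blast
      moreover then obtain A where "A \<in> \<BB>" "x \<in> A" "y \<in> A"
        using common_ball sets.sets_into_space[OF ball_sets[OF B0(1)]] by blast
      ultimately show False
        using subset_hull[of A B\<^sub>0] B0 \<open>S = {}\<close> by (force simp: S_def)
    qed
    define a where "a = (INF A\<in>S. measure M A)"
    \<comment> \<open>This makes \<open>a\<close> positive, so \<open>2 * a\<close> strictly exceeds
      the infimum and some member of \<open>S\<close> has measure below it.\<close>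
    have "2 * measure M B\<^sub>0 \<le> a"
      unfolding a_def using \<open>S \<noteq> {}\<close> by (intro cINF_greatest) (auto simp: S_def)
    then have "a < 2 * a" using measure_ball_pos[OF B0(1)] by simp
    then obtain A where A: "A \<in> S" "measure M A < 2 * a"
      unfolding a_def[symmetric] using cInf_lessD[of "measure M ` S" "2 * a"] \<open>S \<noteq> {}\<close> by (auto simp: a_def)
    have a_le: "a \<le> measure M A'" if "A' \<in> S" for A'
      unfolding a_def using that by (intro cINF_lower) (auto intro!: bdd_belowI[of _ 0])
    have A_ball: "A \<in> \<BB>" "A \<inter> B\<^sub>0 \<noteq> {}" "2 * measure M B\<^sub>0 < measure M A"
      using A by (auto simp: S_def)
    define B where "B = bhull A"
    have B: "B \<in> \<BB>" using A_ball hull_ball by (simp add: B_def)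
    \<comment> \<open>The roles are reversed: now \<open>B\<^sub>0\<close> is the small ball meeting
      \<open>A\<close>. That the inclusion is proper follows from the strict inequality of the
      measures.\<close>
    have "B\<^sub>0 \<subseteq> B"
      unfolding B_def using A_ball B0 measure_ball_pos[OF B0(1)] by (intro subset_hull) auto
    moreover have "measure M B\<^sub>0 < measure M B"
      using measure_ball_mono[of A B] ball_subset_hull[of A] A_ball B measure_ball_pos[OF B0(1)]
      by (simp add: B_def)
    ultimately have B0B: "B\<^sub>0 \<subset> B" by auto
    have hull: "bhull B\<^sub>0 \<subseteq> bhull B" using B0B B0 B by (intro hull_mono) auto
    \<comment> \<open>Near-minimality of \<open>A\<close> gives
      \<open>measure M A < 2 * a \<le> 2 * measure M A'\<close> for every \<open>A'\<close> in
      \<open>S\<close>, so one ball \<open>B\<close> serves all of them.\<close>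
    have large: "measure M (bhull B) \<le> 2 * C\<^sub>0\<^sup>2 * measure M A'" if "A' \<in> S" for A'
    proof -
      have "measure M (bhull B) \<le> C\<^sub>0 * measure M B" using measure_hull_le B by simp
      also have "\<dots> \<le> C\<^sub>0 * (C\<^sub>0 * measure M A)"
        using measure_hull_le A_ball C0 by (intro mult_left_mono) (auto simp: B_def)
      also have "\<dots> \<le> C\<^sub>0 * (C\<^sub>0 * (2 * measure M A'))"
        using A a_le[OF that] C0 by (intro mult_left_mono) auto
      finally show ?thesis by (simp add: power2_eq_square mult_ac)
    qed
    have osc: "ennreal \<bar>?T (restrict_to f (bhull B)) x - ?T (restrict_to f (bhull B\<^sub>0)) x\<bar>
        \<le> ennreal K\<^sub>1 * ?N (bhull B) f" if x: "x \<in> B\<^sub>0" for x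
    proof -
      have "?M (restrict_to f (bhull B)) x \<le>
          ?M (restrict_to f (bhull B\<^sub>0)) x + ennreal K\<^sub>1 * ?N (bhull B) f"
      proof (rule maximal_le)
        fix A'
        assume A': "A' \<in> \<BB>" "x \<in> A'"
        show "?N A' (restrict_to f (bhull B)) \<le>
            ?M (restrict_to f (bhull B\<^sub>0)) x + ennreal K\<^sub>1 * ?N (bhull B) f"
        proof (cases "A' \<in> S")
          case True
          then have "?N A' (restrict_to f (bhull B)) \<le> ennreal K\<^sub>1 * ?N (bhull B) f"
            using A' B f meas hull_ball large by (intro K1) auto
          then show ?thesis by (simp add: add_increasing)
        next
          case False
          then have "A' \<subseteq> bhull B\<^sub>0"
            using A' x B0 by (intro subset_hull) (auto simp: S_def)
          then have "?N A' (restrict_to f (bhull B)) \<le> ?N A' (restrict_to f (bhull B\<^sub>0))"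
            using A' B f meas hull_ball by (intro local_norm_mono growth \<Phi>) (auto simp: indicator_def)
          also have "\<dots> \<le> ?M (restrict_to f (bhull B\<^sub>0)) x"
            by (rule local_norm_le_maximal[OF A'])
          finally show ?thesis by (simp add: add_increasing2)
        qed
      qed
      \<comment> \<open>Finiteness for the cut-off function is inherited from \<open>f\<close>,
        which dominates it pointwise.\<close>
      moreover have "?M (restrict_to f (bhull B)) x \<le> ?M f x"
        using f B hull_ball meas by (intro maximal_mono growth \<Phi>) (auto simp: indicator_def)
      then have "?M (restrict_to f (bhull B)) x < \<infinity>"
        using fin[OF f] by (rule order_le_less_trans)
      ultimately show ?thesis
        using enn2real_diff_bounds[OF mono[OF f hull_ball[OF B0(1)] hull]] by simp
    qed
    show ?thesis
      using B B0B osc by (intro bexI[of _ B] conjI SUP_least) auto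
  qed
  have II: "(SUP (x, x')\<in>B \<times> B. ennreal \<bar>(?T f x - ?T (restrict_to f (bhull B)) x)
        - (?T f x' - ?T (restrict_to f (bhull B)) x')\<bar>)
      \<le> ennreal K\<^sub>2 * orlicz_morrey_sup_norm M \<BB> \<Phi> \<phi> B f"
    if f: "f \<in> ?V" and B: "B \<in> \<BB>" for f B
  proof -
    let ?R = "ennreal K\<^sub>2 * orlicz_morrey_sup_norm M \<BB> \<Phi> \<phi> B f"
    let ?D = "\<lambda>x. ?T f x - ?T (restrict_to f (bhull B)) x"
    have D: "0 \<le> ?D x" "ennreal (?D x) \<le> ?R" if x: "x \<in> B" for x
    proof -
      have lower: "?M (restrict_to f (bhull B)) x \<le> ?M f x"
        using f B hull_ball meas by (intro maximal_mono growth \<Phi>) (auto simp: indicator_def)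
      have upper: "?M f x \<le> ?M (restrict_to f (bhull B)) x + ?R"
      proof (rule maximal_le)
        fix A
        assume A: "A \<in> \<BB>" "x \<in> A"
        show "?N A f \<le> ?M (restrict_to f (bhull B)) x + ?R"
        proof (cases "measure M A \<le> 2 * measure M B")
          case True
          then have "A \<subseteq> bhull B" using A B x by (intro subset_hull) auto
          then have "?N A f \<le> ?N A (restrict_to f (bhull B))"
            using A f meas by (intro local_norm_mono growth \<Phi>) (auto simp: indicator_def)
          also have "\<dots> \<le> ?M (restrict_to f (bhull B)) x"
            by (rule local_norm_le_maximal[OF A])
          finally show ?thesis by (simp add: add_increasing2)
        next
          case False
          then have BA: "B \<subseteq> bhull A"
            using A B x measure_ball_pos[OF B] by (intro subset_hull) auto
          \<comment> \<open>On \<open>A\<close> the function agrees with its cut-off to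
            \<open>bhull A\<close>. This brings in the norm on \<open>bhull A\<close>, a ball
            containing \<open>B\<close> and therefore one of those in the supremum on the
            right.\<close>
          have "?N A f \<le> ?N A (restrict_to f (bhull A))"
            using A f meas ball_subset_hull[OF A(1)]
            by (intro local_norm_mono growth \<Phi>) (auto simp: indicator_def)
          also have "\<dots> \<le> ennreal K\<^sub>2 * ?N (bhull A) f"
            using A f meas hull_ball measure_hull_le by (intro K2) auto
          also have "\<dots> \<le> ?R"
            unfolding orlicz_morrey_sup_norm_def
            using A BA hull_ball by (intro mult_left_mono SUP_upper) auto
          finally show ?thesis by (simp add: add_increasing)
        qed
      qed
      show "0 \<le> ?D x" "ennreal (?D x) \<le> ?R"
        using enn2real_diff_bounds[OF lower fin[OF f] upper] by auto
    qed
    have "ennreal \<bar>?D x - ?D x'\<bar> \<le> ?R" if x: "x \<in> B" "x' \<in> B" for x x'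
    proof -
      \<comment> \<open>Both values lie between 0 and \<open>?R\<close>, so their difference is
        bounded by the larger one and no factor 2 is lost.\<close>
      have "\<bar>?D x - ?D x'\<bar> \<le> max (?D x) (?D x')"
        using D(1)[OF x(1)] D(1)[OF x(2)] by linarith
      then have "ennreal \<bar>?D x - ?D x'\<bar> \<le> ennreal (max (?D x) (?D x'))"
        by (rule ennreal_leI)
      also have "\<dots> \<le> ?R"
        using D(2) x by (simp add: max_def)
      finally show ?thesis .
    qed
    then show ?thesis by (intro SUP_least) auto
  qed
  have "bounded_oscillation_operator M \<BB> bhull \<Phi> \<Psi> \<phi> \<psi> ?T"
    unfolding bounded_oscillation_operator_def
  proof (rule conjI[OF disjI2[OF sub]], rule exI[of _ "K\<^sub>1"], rule exI[of _ "K\<^sub>2"],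
      intro conjI ballI impI)
  qed (use K1(1) K2(1) I II in auto)
  then show ?thesis using fin by blast
qed

end
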